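(* Let $d\geq 2$ be an integer. Then there is a positive integer $N_d$ such that $$\left(\frac{1}{d!\,\zeta(d)}\right)n^d\leq\beta_n^d\leq n^d\quad\text{for all } n>N_d,$$ where $\zeta$ is the Riemann zeta function.
   Context: $\mathbb{Z}_n$ is the ring of integers modulo $n$, identified with $\{0,\dots,n-1\}$; a vector $(v_1,\dots,v_d)\in\mathbb{Z}_n^d$ is zero-sum-free if no non-empty subset of its components sums to $0$ in $\mathbb{Z}_n$; $\beta_n^d$ is the number of zero-sum-free $(x_1,\dots,x_d)\in\mathbb{Z}_n^d$ with $\gcd(x_1,\dots,x_d,n)=1$. *)

theory Defs
  imports "HOL-Analysis.Analysis" "HOL-Number_Theory.Cong"
begin

text \<open>Elements of \<open>\<int>\<^sub>n\<close> are represented by \<open>{0..<n}\<close>, vectors by extensional functions on \<open>{1..d}\<close>.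
  A subset of the components is a set of positions, so equal entries at different
  positions count separately.\<close>

definition Zn_vectors :: "nat \<Rightarrow> nat \<Rightarrow> (nat \<Rightarrow> nat) set" where
  "Zn_vectors n d = {1..d} \<rightarrow>\<^sub>E {0..<n}"

definition zero_sum_free :: "nat \<Rightarrow> nat \<Rightarrow> (nat \<Rightarrow> nat) \<Rightarrow> bool" where
  "zero_sum_free n d v \<longleftrightarrow>
     (\<forall>I. I \<subseteq> {1..d} \<and> I \<noteq> {} \<longrightarrow> \<not> [(\<Sum>i\<in>I. v i) = 0] (mod n))"

definition zsf_beta :: "nat \<Rightarrow> nat \<Rightarrow> nat" where
  "zsf_beta n d =
     card {x \<in> Zn_vectors n d. zero_sum_free n d x \<and> Gcd (insert n (x ` {1..d})) = 1}"

text \<open>The Riemann zeta function, by its Dirichlet series; meaningful for real \<open>s > 1\<close> only.\<close>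

definition riemann_zeta :: "real \<Rightarrow> real" where
  "riemann_zeta s = (\<Sum>k. 1 / real (Suc k) powr s)"

lemma riemann_zeta_sums:
  assumes "s > 1"
  shows "(\<lambda>k. 1 / real (Suc k) powr s) sums riemann_zeta s"
proof -
  have "summable (\<lambda>k. real k powr (-s))"
    using assms by (simp add: summable_real_powr_iff)
  then have "summable (\<lambda>k. real (Suc k) powr (-s))"
    by (subst summable_Suc_iff)
  then have "summable (\<lambda>k. 1 / real (Suc k) powr s)"
    by (simp only: powr_minus_divide)
  then show ?thesis
    unfolding riemann_zeta_def by (rule summable_sums)
qed

end

theory Submission
  imports Defs
begin

text \<open>Union bounds suffice. A vector whose gcd with \<open>n\<close> is \<open>g \<ge> 2\<close> is one of \<open>(n/g)\<^sup>d\<close>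
  vectors of multiples of \<open>g\<close>, so at most \<open>(\<zeta>(d) - 1) n\<^sup>d\<close> vectors violate the gcd condition; a fixed
  non-empty set of positions has vanishing sum for at most \<open>n\<^bsup>d-1\<^esup>\<close> vectors, so at most
  \<open>2\<^sup>d n\<^bsup>d-1\<^esup>\<close> vectors fail to be zero-sum-free. Writing \<open>z = \<zeta>(d)\<close>, the bound
  \<open>(2 - z) n\<^sup>d - 2\<^sup>d n\<^bsup>d-1\<^esup>\<close> eventually beats \<open>n\<^sup>d / (2 z)\<close>, because
  \<open>2 - z > 1 / (2 z)\<close> is equivalent to \<open>(z - 1)\<^sup>2 < 1/2\<close>, and
  \<open>z \<le> \<zeta>(2) = \<pi>\<^sup>2/6 < 1.7\<close>.\<close>

lemma finite_Zn_vectors: "finite (Zn_vectors n d)"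
  unfolding Zn_vectors_def by (intro finite_PiE) auto

lemma card_Zn_vectors: "card (Zn_vectors n d) = n ^ d"
  unfolding Zn_vectors_def by (simp add: card_PiE)

text \<open>Fix some \<open>j\<close> in \<open>I\<close>. The entries off \<open>j\<close> and the
  vanishing sum determine \<open>x j\<close> modulo \<open>n\<close>, hence \<open>x j\<close>
  itself because entries lie below \<open>n\<close>. So deleting position \<open>j\<close> is
  injective on these vectors.\<close>

lemma card_Zn_vectors_zero_sum_le:
  assumes "I \<subseteq> {1..d}" "I \<noteq> {}"
  shows "card {x \<in> Zn_vectors n d. [(\<Sum>i\<in>I. x i) = 0] (mod n)} \<le> n ^ (d - 1)"
proof -
  let ?A = "{x \<in> Zn_vectors n d. [(\<Sum>i\<in>I. x i) = 0] (mod n)}"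
  obtain j where j: "j \<in> I" using assms by auto
  with assms have jd: "j \<in> {1..d}" by auto
  have finI: "finite I" using assms(1) finite_subset by blast
  let ?J = "{1..d} - {j}"
  let ?r = "\<lambda>x::nat \<Rightarrow> nat. restrict x ?J"
  have "inj_on ?r ?A"
  proof (rule inj_onI)
    fix x y assume x: "x \<in> ?A" and y: "y \<in> ?A" and eq: "?r x = ?r y"
    have off: "x i = y i" if "i \<in> ?J" for i
      using fun_cong[OF eq, of i] that by simp
    have "(\<Sum>i\<in>I. v i) = v j + (\<Sum>i\<in>I - {j}. v i)" for v :: "nat \<Rightarrow> nat"
      using finI j by (rule sum.remove)
    moreover have "(\<Sum>i\<in>I - {j}. x i) = (\<Sum>i\<in>I - {j}. y i)"
      using off assms(1) by (intro sum.cong) auto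
    moreover have "[(\<Sum>i\<in>I. x i) = (\<Sum>i\<in>I. y i)] (mod n)"
      using x y by (auto intro: cong_trans cong_sym)
    ultimately have "[x j = y j] (mod n)"
      by (simp add: cong_add_rcancel_nat)
    moreover have "x j < n" "y j < n"
      using x y jd by (auto simp: Zn_vectors_def PiE_iff)
    ultimately have "x j = y j"
      by (simp add: cong_less_modulus_unique_nat)
    with off have "x i = y i" if "i \<in> {1..d}" for i
      using that by (cases "i = j") auto
    with x y show "x = y"
      unfolding Zn_vectors_def by (auto intro: PiE_ext)
  qed
  moreover have "?r ` ?A \<subseteq> ?J \<rightarrow>\<^sub>E {0..<n}"
    by (auto simp: Zn_vectors_def PiE_iff split: if_splits)
  moreover have "finite (?J \<rightarrow>\<^sub>E {0..<n})"
    by (intro finite_PiE) auto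
  ultimately have "card ?A \<le> card (?J \<rightarrow>\<^sub>E {0..<n})"
    by (rule card_inj_on_le)
  also have "\<dots> = n ^ (d - 1)"
    using jd by (simp add: card_PiE)
  finally show ?thesis .
qed

lemma card_not_zero_sum_free_le:
  "card {x \<in> Zn_vectors n d. \<not> zero_sum_free n d x} \<le> 2 ^ d * n ^ (d - 1)"
proof -
  let ?P = "Pow {1..d} - {{}}"
  let ?Z = "\<lambda>I. {x \<in> Zn_vectors n d. [(\<Sum>i\<in>I. x i) = 0] (mod n)}"
  have "{x \<in> Zn_vectors n d. \<not> zero_sum_free n d x} = (\<Union>I\<in>?P. ?Z I)"
    unfolding zero_sum_free_def by blast
  then have "card {x \<in> Zn_vectors n d. \<not> zero_sum_free n d x} \<le> (\<Sum>I\<in>?P. card (?Z I))"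
    by (simp only:) (rule card_UN_le, simp)
  also have "\<dots> \<le> (\<Sum>I\<in>?P. n ^ (d - 1))"
    by (intro sum_mono card_Zn_vectors_zero_sum_le) auto
  also have "\<dots> = card ?P * n ^ (d - 1)"
    by simp
  also have "card ?P \<le> card (Pow {1..d})"
    by (intro card_mono) auto
  also have "card (Pow {1..d}) = 2 ^ d"
    by (simp add: card_Pow)
  finally show ?thesis by simp
qed

text \<open>Dividing all entries by \<open>g\<close> lands in vectors over
  \<open>{0..<n div g}\<close>, and scaling by \<open>g\<close> recovers the original
  vector.\<close>

lemma card_Zn_vectors_multiples_le:
  assumes "g dvd n" "g > 0"
  shows "card {x \<in> Zn_vectors n d. \<forall>i\<in>{1..d}. g dvd x i} \<le> (n div g) ^ d"
proof -
  let ?A = "{x \<in> Zn_vectors n d. \<forall>i\<in>{1..d}. g dvd x i}"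
  let ?f = "\<lambda>y::nat \<Rightarrow> nat. restrict (\<lambda>i. g * y i) {1..d}"
  have "?A \<subseteq> ?f ` Zn_vectors (n div g) d"
  proof
    fix x assume x: "x \<in> ?A"
    let ?y = "restrict (\<lambda>i. x i div g) {1..d}"
    have "?y \<in> Zn_vectors (n div g) d"
      using x assms by (auto simp: Zn_vectors_def PiE_iff intro!: div_less_mono)
    moreover have "x = ?f ?y"
      using x by (auto simp: Zn_vectors_def PiE_iff restrict_def fun_eq_iff extensional_def)
    ultimately show "x \<in> ?f ` Zn_vectors (n div g) d" by blast
  qed
  then have "card ?A \<le> card (Zn_vectors (n div g) d)"
    by (intro surj_card_le finite_Zn_vectors)
  then show ?thesis by (simp add: card_Zn_vectors)
qed

text \<open>A partial sum of a series with non-negative terms. Natural-number powers replace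
  \<open>powr\<close> to match the counts \<open>(n div g) ^ d\<close>.\<close>

lemma sum_inverse_powers_le_riemann_zeta:
  assumes "d \<ge> 2"
  shows "(\<Sum>g=1..n. 1 / real g ^ d) \<le> riemann_zeta (real d)"
proof -
  have s: "(\<lambda>k. 1 / real (Suc k) powr real d) sums riemann_zeta (real d)"
    using assms by (intro riemann_zeta_sums) simp
  have "(\<Sum>g=1..n. 1 / real g ^ d) = (\<Sum>k<n. 1 / real (Suc k) powr real d)"
    by (rule sum.reindex_bij_witness[of _ Suc "\<lambda>g. g - 1"]) (auto simp: powr_realpow)
  also have "\<dots> \<le> (\<Sum>k. 1 / real (Suc k) powr real d)"
    using s by (intro sum_le_suminf) (auto simp: sums_iff)
  also have "\<dots> = riemann_zeta (real d)"
    using s by (simp add: sums_iff)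
  finally show ?thesis .
qed

lemma card_gcd_not_one_le:
  assumes "d \<ge> 2" "n > 0"
  shows "real (card {x \<in> Zn_vectors n d. Gcd (insert n (x ` {1..d})) \<noteq> 1})
           \<le> (riemann_zeta (real d) - 1) * real n ^ d"
proof -
  let ?B = "{x \<in> Zn_vectors n d. Gcd (insert n (x ` {1..d})) \<noteq> 1}"
  let ?G = "{g \<in> {2..n}. g dvd n}"
  let ?M = "\<lambda>g. {x \<in> Zn_vectors n d. \<forall>i\<in>{1..d}. g dvd x i}"
  have "?B \<subseteq> (\<Union>g\<in>?G. ?M g)"
  proof
    fix x assume x: "x \<in> ?B"
    let ?g = "Gcd (insert n (x ` {1..d}))"
    have dvd: "?g dvd n" "\<forall>i\<in>{1..d}. ?g dvd x i"
      by (auto intro: Gcd_dvd simp del: Gcd_insert)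
    \<comment> \<open>Here \<open>n > 0\<close> matters: it rules out gcd 0 and bounds the gcd by
      \<open>n\<close>.\<close>
    moreover from dvd(1) have g: "?g \<noteq> 0" "?g \<le> n"
      using assms(2) dvd_imp_le by (auto simp del: Gcd_insert)
    moreover from x have "?g \<noteq> 1" by simp
    with g(1) have "2 \<le> ?g" by linarith
    ultimately have "?g \<in> ?G" by (simp del: Gcd_insert)
    moreover have "x \<in> ?M ?g" using x dvd(2) by blast
    ultimately show "x \<in> (\<Union>g\<in>?G. ?M g)" by blast
  qed
  then have "card ?B \<le> card (\<Union>g\<in>?G. ?M g)"
    by (intro card_mono) (simp_all add: finite_Zn_vectors)
  also have "\<dots> \<le> (\<Sum>g\<in>?G. card (?M g))"
    by (rule card_UN_le) simp
  also have "\<dots> \<le> (\<Sum>g\<in>?G. (n div g) ^ d)"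
    by (intro sum_mono card_Zn_vectors_multiples_le) auto
  finally have "real (card ?B) \<le> (\<Sum>g\<in>?G. real ((n div g) ^ d))"
    by (simp only: of_nat_le_iff flip: of_nat_sum)
  also have "\<dots> = (\<Sum>g\<in>?G. real n ^ d * (1 / real g ^ d))"
    by (intro sum.cong) (auto simp: real_of_nat_div power_divide)
  also have "\<dots> \<le> (\<Sum>g=2..n. real n ^ d * (1 / real g ^ d))"
    by (intro sum_mono2) auto
  \<comment> \<open>The subtracted 1 is the term \<open>g = 1\<close>.\<close>
  also have "\<dots> = real n ^ d * ((\<Sum>g=1..n. 1 / real g ^ d) - 1)"
    using assms(2) sum.atLeast_Suc_atMost[of 1 n "\<lambda>g. 1 / real g ^ d"]
    by (simp add: sum_distrib_left numeral_2_eq_2)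
  also have "\<dots> \<le> real n ^ d * (riemann_zeta (real d) - 1)"
    using sum_inverse_powers_le_riemann_zeta[OF assms(1), of n] by (intro mult_left_mono) auto
  finally show ?thesis by (simp add: mult.commute)
qed

lemma riemann_zeta_ge_1: "d \<ge> 2 \<Longrightarrow> riemann_zeta (real d) \<ge> 1"
  using sum_inverse_powers_le_riemann_zeta[of d 1] by simp

lemma riemann_zeta_le:
  assumes "d \<ge> 2"
  shows "riemann_zeta (real d) \<le> 17 / 10"
proof -
  have "riemann_zeta (real d) \<le> pi\<^sup>2 / 6"
  proof (rule sums_le)
    show "(\<lambda>k. 1 / real (Suc k) powr real d) sums riemann_zeta (real d)"
      using assms by (intro riemann_zeta_sums) simp
    show "(\<lambda>k. 1 / real (k + 1) ^ 2) sums (pi\<^sup>2 / 6)"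
      using inverse_squares_sums by (simp add: add.commute)
    show "1 / real (Suc k) powr real d \<le> 1 / real (k + 1) ^ 2" for k
    proof -
      have "real (Suc k) ^ 2 \<le> real (Suc k) ^ d"
        using assms by (intro power_increasing) auto
      then show ?thesis
        by (simp add: powr_realpow frac_le)
    qed
  qed
  \<comment> \<open>The rational bound suffices since 3.19 squared is 10.1761, below 6 * 1.7 =
    10.2.\<close>
  also have "pi\<^sup>2 \<le> (319 / 100)\<^sup>2"
    using pi_less_4 pi_approx by (intro power_mono) auto
  finally show ?thesis by (simp add: power2_eq_square)
qed

lemma zsf_beta_le: "zsf_beta n d \<le> n ^ d"
  unfolding zsf_beta_def card_Zn_vectors[symmetric]
  by (intro card_mono finite_Zn_vectors) auto

text \<open>Every vector is counted by \<open>zsf_beta\<close> or violates one of its two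
  conditions. The gcd condition costs a share \<zeta>(d) - 1 of all vectors, leaving 2 -
  \<zeta>(d).\<close>

lemma zsf_beta_ge:
  assumes "d \<ge> 2" "n > 0"
  shows "real (zsf_beta n d) \<ge> (2 - riemann_zeta (real d)) * real n ^ d - 2 ^ d * real n ^ (d - 1)"
proof -
  let ?S = "{x \<in> Zn_vectors n d. zero_sum_free n d x \<and> Gcd (insert n (x ` {1..d})) = 1}"
  let ?B = "{x \<in> Zn_vectors n d. Gcd (insert n (x ` {1..d})) \<noteq> 1}"
  let ?C = "{x \<in> Zn_vectors n d. \<not> zero_sum_free n d x}"
  have "Zn_vectors n d = ?S \<union> (?B \<union> ?C)" by blast
  then have "n ^ d = card (?S \<union> (?B \<union> ?C))"
    using card_Zn_vectors by metis
  also have "\<dots> \<le> card ?S + (card ?B + card ?C)"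
    by (meson add_left_mono card_Un_le order_trans)
  also have "\<dots> \<le> card ?S + (card ?B + 2 ^ d * n ^ (d - 1))"
    using card_not_zero_sum_free_le by (intro add_left_mono)
  finally have "real (n ^ d) \<le> real (card ?S + (card ?B + 2 ^ d * n ^ (d - 1)))"
    by (rule of_nat_mono)
  then have "real n ^ d \<le> real (zsf_beta n d) + (real (card ?B) + 2 ^ d * real n ^ (d - 1))"
    unfolding zsf_beta_def by simp
  with card_gcd_not_one_le[OF assms] show ?thesis
    by (simp add: algebra_simps)
qed

theorem theorem6p5:
  fixes d :: nat
  assumes "d \<ge> 2"
  shows "\<exists>N::nat. N > 0 \<and> (\<forall>n>N.
           (1 / (fact d * riemann_zeta (real d))) * real n ^ d \<le> real (zsf_beta n d) \<and>
           real (zsf_beta n d) \<le> real n ^ d)"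
\<comment> \<open>For \<open>n\<close> above this threshold the error
  \<open>2 ^ d * n ^ (d - 1)\<close> is at most \<open>n ^ d / 200\<close>, a loss that the main
  inequality can afford.\<close>
proof (intro exI[of _ "200 * 2 ^ d"] conjI allI impI)
  show "0 < 200 * (2::nat) ^ d" by simp
  fix n :: nat assume n: "200 * 2 ^ d < n"
  then have n0: "n > 0" by simp
  define z where "z = riemann_zeta (real d)"
  have z: "1 \<le> z" "z \<le> 17 / 10"
    unfolding z_def using riemann_zeta_ge_1 riemann_zeta_le assms by auto
  have "fact d \<ge> (fact 2 :: real)"
    using assms by (intro fact_mono)
  then have "1 / (fact d * z) \<le> 1 / (2 * z)"
    using z by (intro divide_left_mono mult_right_mono) (auto simp: fact_2)
  also have "\<dots> \<le> 2 - z - 1 / 200"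
  proof -
    have "(z - 1) * (z - 1) \<le> (7 / 10) * (7 / 10)"
      using z by (intro mult_mono) auto
    \<comment> \<open>Indeed 2z(2 - z) = 2 - 2(z - 1)^2 is at least 1.02, and the slack 1/200 costs
      z/100, at most 0.017.\<close>
    then have "1 \<le> (2 - z - 1 / 200) * (2 * z)"
      using z by (simp add: algebra_simps)
    then show ?thesis
      using z by (simp add: pos_divide_le_eq)
  qed
  finally have "1 / (fact d * z) * real n ^ d \<le> (2 - z - 1 / 200) * real n ^ d"
    by (rule mult_right_mono) simp
  also have "2 ^ d * real n ^ (d - 1) \<le> (real n / 200) * real n ^ (d - 1)"
  proof (rule mult_right_mono)
    have "real (200 * 2 ^ d) < real n" using n by (rule of_nat_less_iff[THEN iffD2])
    then show "2 ^ d \<le> real n / 200" by simp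
  qed simp
  \<comment> \<open>As \<open>d\<close> is positive, \<open>n * n ^ (d - 1)\<close> is
    \<open>n ^ d\<close>, so the reserved 1/200 share pays for the error term.\<close>
  then have "(2 - z - 1 / 200) * real n ^ d \<le> (2 - z) * real n ^ d - 2 ^ d * real n ^ (d - 1)"
    using assms by (simp add: algebra_simps power_eq_if)
  also have "\<dots> \<le> real (zsf_beta n d)"
    unfolding z_def using zsf_beta_ge assms n0 by blast
  finally show "1 / (fact d * riemann_zeta (real d)) * real n ^ d \<le> real (zsf_beta n d)"
    unfolding z_def .
  show "real (zsf_beta n d) \<le> real n ^ d"
    using zsf_beta_le by (simp only: of_nat_le_iff flip: of_nat_power)
qed

end
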